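(* Let $(\mathcal{R},\oplus,\leqslant)$ be a lattice ordered monoid with neutral element $0$ whose lattice is conditionally complete, let $D=(V,A)$ be a finite digraph with $o,d\in V$, let $(x_a)_{a\in A}\in\mathcal{R}^A$, let $c:\mathcal{R}\to\mathbb{R}$ and $\rho:\mathcal{R}\to\{0,1\}$ be isotone, and for each $v\in V$ let $b_v\in\mathcal{R}$ satisfy $b_v\leqslant x_P$ for every $v$-$d$ path $P$. Consider the two assumptions: (W) for all $a,b<\bigvee\mathcal{R}$ and all $x>0$ in $\mathcal{R}$, there exists $n\in\mathbb{Z}_+$ such that $nx\oplus a\not\leqslant b$, where $nx=x\oplus\cdots\oplus x$ ($n$ times); (B) there exists a feasible $o$-$d$ path $P$ such that $c^{-1}\big((-\infty,c(x_P)]\big)\cap\rho^{-1}(0)$ is upper-bounded by a resource $x_M<\bigvee\mathcal{R}$. Suppose that at least one of the following conditions is satisfied: (a) $D$ is acyclic; (b) (W) and (B) are satisfied, $x_a>0$ for each arc $a$, and $b_v\geqslant 0$ for each vertex $v$; (c) (W) and (B) are satisfied, $\oplus$ is commutative, and $\bigoplus_{a\in C}x_a>0$ for every cycle $C$ in $D$. Then the generalized A$^*$ algorithm (run with the bounds $b_v$) terminates after a finite number of iterations, and at the end, if $c_{od}^{UB}$ is finite, then it is the cost of an optimal solution of the Monoid Resource Constrained Shortest Path Problem; otherwise, the problem admits no feasible solution.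
   Context: A lattice ordered monoid $(\mathcal{R},\oplus,\leqslant)$ is a monoid $(\mathcal{R},\oplus)$ (associative, with neutral element $0$, possibly non-commutative) with a partial order $\leqslant$ that is a lattice order and is such that all translations $y\mapsto x\oplus y$ and $y\mapsto y\oplus x$ are isotone (order-preserving). Conditionally complete: every nonempty bounded subset has a meet and a join. $\bigvee\mathcal{R}$ is the least upper bound of $\mathcal{R}$; if it does not exist in $\mathcal{R}$ it is the element $+\infty$ of the completion $\mathcal{R}\cup\{-\infty,+\infty\}$, which is greater than every element of $\mathcal{R}$. Paths are finite sequences of arcs, the head of each being the tail of the next; vertices and arcs may be repeated, and empty paths (one at each vertex, with resource $0$) are allowed. A cycle is a nonempty path whose origin equals its destination. The resource of a path $P=(a_1,\dots,a_k)$ is $x_P=x_{a_1}\oplus\cdots\oplus x_{a_k}$. $P$ is feasible if $\rho(x_P)=0$; its cost is $c(x_P)$. The Monoid Resource Constrained Shortest Path Problem asks for a feasible $o$-$d$ path of minimum cost; an optimal solution is such a path. Generalized A$^*$ algorithm: maintain a list $L$ of paths with origin $o$ and a value $c_{od}^{UB}\in\mathbb{R}\cup\{+\infty\}$. Initially $L$ contains only the empty path at $o$ and $c_{od}^{UB}=+\infty$. While $L$ is nonempty, repeat: (1) extract (remove) from $L$ a path $P$, with destination denoted $v$, of minimum key $c(x_P\oplus b_v)$ among the paths of $L$ (ties broken arbitrarily); (2) if $v=d$, $\rho(x_P)=0$ and $c(x_P)<c_{od}^{UB}$, then set $c_{od}^{UB}:=c(x_P)$; (3) else, if the lower bound test "$\rho(x_P\oplus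 b_v)=0$ and $c(x_P\oplus b_v)\leq c_{od}^{UB}$" holds, extend $P$: for each arc $a$ outgoing from $v$, add $P+a$ ($P$ followed by $a$) to $L$. *)

theory Defs
  imports Complex_Main "HOL-Library.Extended" "HOL-Library.Multiset" "Graph_Theory.Arc_Walk"
begin

text \<open>
  The monoid operation \<open>\<oplus>\<close> is written \<open>+\<close>; it is not assumed to be commutative.
  Conditional completeness is the additional sort constraint
  \<^class>\<open>conditionally_complete_lattice\<close>.  That class asks for joins of nonempty sets bounded above
  and meets of nonempty sets bounded below; in a lattice this is equivalent to asking for joins and
  meets of nonempty sets bounded on both sides.
\<close>

class lattice_ordered_monoid = monoid_add + lattice +
  assumes translation_left_isotone: "y \<le> z \<Longrightarrow> x + y \<le> x + z"
    and translation_right_isotone: "y \<le> z \<Longrightarrow> y + x \<le> z + x"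

text \<open>
  The join of the whole monoid, as an element of its completion.  In a conditionally complete
  lattice the least upper bound of the universe exists iff the universe is bounded above.
\<close>

definition monoid_join :: "'r::conditionally_complete_lattice extended" where
  "monoid_join = (if bdd_above (UNIV :: 'r set) then Fin (Sup UNIV) else Pinf)"

text \<open>
  A path is the list of its arcs, as in \<open>awalk\<close>: vertices and arcs may be repeated, and the empty
  list is a path from every vertex to itself.  A cycle is a \<open>closed_w\<close> of the library: it is
  nonempty and closed but may repeat vertices, unlike the library's \<open>cycle\<close>.
\<close>

definition path_resource :: "('e \<Rightarrow> 'r::monoid_add) \<Rightarrow> 'e awalk \<Rightarrow> 'r" where
  "path_resource x P = sum_list (map x P)"

definition feasible_path ::
  "('v, 'e) pre_digraph \<Rightarrow> 'v \<Rightarrow> 'v \<Rightarrow> ('e \<Rightarrow> 'r::monoid_add) \<Rightarrow> ('r \<Rightarrow> nat) \<Rightarrow> 'e awalk \<Rightarrow> bool" where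
  "feasible_path G orig dest x \<rho> P \<longleftrightarrow>
     pre_digraph.awalk G orig P dest \<and> \<rho> (path_resource x P) = 0"

definition optimal_path ::
  "('v, 'e) pre_digraph \<Rightarrow> 'v \<Rightarrow> 'v \<Rightarrow> ('e \<Rightarrow> 'r::monoid_add) \<Rightarrow> ('r \<Rightarrow> real) \<Rightarrow> ('r \<Rightarrow> nat)
     \<Rightarrow> 'e awalk \<Rightarrow> bool" where
  "optimal_path G orig dest x c \<rho> P \<longleftrightarrow>
     feasible_path G orig dest x \<rho> P \<and>
     (\<forall>Q. feasible_path G orig dest x \<rho> Q \<longrightarrow> c (path_resource x P) \<le> c (path_resource x Q))"

definition assumption_W :: "'r::{lattice_ordered_monoid, conditionally_complete_lattice} itself \<Rightarrow> bool" where
  "assumption_W TYPE('r) \<longleftrightarrow>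
     (\<forall>a b x :: 'r. Fin a < monoid_join \<and> Fin b < monoid_join \<and> 0 < x \<longrightarrow>
        (\<exists>n. \<not> sum_list (replicate n x) + a \<le> b))"

definition assumption_B ::
  "('v, 'e) pre_digraph \<Rightarrow> 'v \<Rightarrow> 'v
     \<Rightarrow> ('e \<Rightarrow> 'r::{lattice_ordered_monoid, conditionally_complete_lattice})
     \<Rightarrow> ('r \<Rightarrow> real) \<Rightarrow> ('r \<Rightarrow> nat) \<Rightarrow> bool" where
  "assumption_B G orig dest x c \<rho> \<longleftrightarrow>
     (\<exists>P. feasible_path G orig dest x \<rho> P \<and>
        (\<exists>x\<^sub>M. Fin x\<^sub>M < monoid_join \<and>
           (\<forall>r \<in> c -` {..c (path_resource x P)} \<inter> \<rho> -` {0}. r \<le> x\<^sub>M)))"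

text \<open>
  A state of the algorithm consists of the list \<open>L\<close> (a multiset, since ties between minimum keys
  are broken arbitrarily) and the upper bound.  Every path in \<open>L\<close> has origin \<open>orig\<close>, which is
  therefore not stored; it only matters for the destination of the empty path.
\<close>

type_synonym 'e astar_state = "'e awalk multiset \<times> real extended"

definition path_dest :: "('v, 'e) pre_digraph \<Rightarrow> 'v \<Rightarrow> 'e awalk \<Rightarrow> 'v" where
  "path_dest G orig P = last (pre_digraph.awalk_verts G orig P)"

definition bounded_resource ::
  "('v, 'e) pre_digraph \<Rightarrow> 'v \<Rightarrow> ('e \<Rightarrow> 'r::monoid_add) \<Rightarrow> ('v \<Rightarrow> 'r) \<Rightarrow> 'e awalk \<Rightarrow> 'r" where
  "bounded_resource G orig x b P = path_resource x P + b (path_dest G orig P)"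

definition astar_init :: "'e astar_state" where
  "astar_init = ({#[]#}, Pinf)"

text \<open>One iteration, after the path \<open>P\<close> has been removed from the list.\<close>

definition astar_process ::
  "('v, 'e) pre_digraph \<Rightarrow> 'v \<Rightarrow> 'v \<Rightarrow> ('e \<Rightarrow> 'r::monoid_add) \<Rightarrow> ('r \<Rightarrow> real) \<Rightarrow> ('r \<Rightarrow> nat)
     \<Rightarrow> ('v \<Rightarrow> 'r) \<Rightarrow> 'e awalk \<Rightarrow> 'e astar_state \<Rightarrow> 'e astar_state" where
  "astar_process G orig dest x c \<rho> b P = (\<lambda>(L, UB).
     if path_dest G orig P = dest \<and> \<rho> (path_resource x P) = 0 \<and> Fin (c (path_resource x P)) < UB
       then (L, Fin (c (path_resource x P)))
     else if \<rho> (bounded_resource G orig x b P) = 0 \<and> Fin (c (bounded_resource G orig x b P)) \<le> UB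
       then (L + {# P @ [a]. a \<in># mset_set (out_arcs G (path_dest G orig P)) #}, UB)
     else (L, UB))"

inductive astar_step ::
  "('v, 'e) pre_digraph \<Rightarrow> 'v \<Rightarrow> 'v \<Rightarrow> ('e \<Rightarrow> 'r::monoid_add) \<Rightarrow> ('r \<Rightarrow> real) \<Rightarrow> ('r \<Rightarrow> nat)
     \<Rightarrow> ('v \<Rightarrow> 'r) \<Rightarrow> 'e astar_state \<Rightarrow> 'e astar_state \<Rightarrow> bool"
  for G orig dest x c \<rho> b where
  "astar_step G orig dest x c \<rho> b (L, UB) (astar_process G orig dest x c \<rho> b P (L - {#P#}, UB))"
    if "P \<in># L"
      and "\<forall>Q \<in># L. c (bounded_resource G orig x b P) \<le> c (bounded_resource G orig x b Q)"

text \<open>The only states without a successor are those with an empty list.\<close>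

lemma astar_step_total_iff:
  "(\<exists>t. astar_step G orig dest x c \<rho> b (L, UB) t) \<longleftrightarrow> L \<noteq> {#}"
proof
  assume "\<exists>t. astar_step G orig dest x c \<rho> b (L, UB) t"
  then show "L \<noteq> {#}" by (auto elim: astar_step.cases)
next
  assume "L \<noteq> {#}"
  let ?k = "\<lambda>P. c (bounded_resource G orig x b P)"
  have "finite (?k ` set_mset L)" "?k ` set_mset L \<noteq> {}"
    using \<open>L \<noteq> {#}\<close> by auto
  from Min_in[OF this] obtain P where "P \<in># L" "?k P = Min (?k ` set_mset L)"
    by auto
  then have "\<forall>Q \<in># L. ?k P \<le> ?k Q" by simp
  with \<open>P \<in># L\<close> show "\<exists>t. astar_step G orig dest x c \<rho> b (L, UB) t"
    by (blast intro: astar_step.intros)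
qed

end

theory Submission
  imports Defs
begin

text \<open>
  A feasible \<open>orig\<close>-\<open>dest\<close> path \<open>Q\<close> is never lost: as long as the upper bound exceeds its cost, some
  prefix of \<open>Q\<close> is in the list, because \<open>b\<close> bounds the resource of the rest of \<open>Q\<close> and so every
  prefix passes the lower bound test.  A prefix that ends at \<open>dest\<close> and updates the upper bound is not
  extended, but it differs from \<open>Q\<close> by a closed walk, whose resource is nonnegative.

  For termination, a prefix of \<open>Q\<close> in the list also has key at most the cost of \<open>Q\<close>, and an extended
  path has minimum key; so every extended path \<open>P\<close> satisfies \<open>c (x\<^sub>P \<oplus> b\<^sub>v) \<le> c (x\<^sub>Q)\<close> for every
  feasible \<open>Q\<close>, and by (B) \<open>x\<^sub>P \<oplus> b\<^sub>v \<le> x\<^sub>M\<close>.  Finitely many positive resources, those of the arcs in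
  case (b) and those of the short closed walks in case (c), make up \<open>x\<^sub>P\<close>, so a long \<open>P\<close> repeats one
  of them many times, which contradicts (W).  Once the length of the extended paths is bounded, the
  list decreases in the multiset order.
\<close>

section \<open>Sums of nonnegative resources and a length bound from (W)\<close>

lemma sum_list_nonneg_lom:
  fixes ks :: "'r::lattice_ordered_monoid list"
  assumes "\<And>k. k \<in> set ks \<Longrightarrow> 0 \<le> k"
  shows "0 \<le> sum_list ks"
  using assms
proof (induction ks)
  case (Cons k ks)
  then have "0 \<le> k" "0 \<le> sum_list ks" by auto
  then show ?case
    using translation_left_isotone[of 0 "sum_list ks" k] by simp
qed simp

lemma sum_list_filter_le_lom:
  fixes ks :: "'r::lattice_ordered_monoid list"
  assumes "\<And>k. k \<in> set ks \<Longrightarrow> 0 \<le> k"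
  shows "sum_list (filter P ks) \<le> sum_list ks"
  using assms
proof (induction ks)
  case (Cons k ks)
  then have IH: "sum_list (filter P ks) \<le> sum_list ks" and k: "0 \<le> k" by auto
  have "sum_list ks \<le> k + sum_list ks"
    using translation_right_isotone[OF k, of "sum_list ks"] by simp
  with IH have "sum_list (filter P ks) \<le> k + sum_list ks" by (rule order_trans)
  moreover have "k + sum_list (filter P ks) \<le> k + sum_list ks"
    using IH by (rule translation_left_isotone)
  ultimately show ?case by simp
qed simp

lemma sum_list_replicate_mono_lom:
  fixes k :: "'r::lattice_ordered_monoid"
  assumes "0 \<le> k" and "m \<le> n"
  shows "sum_list (replicate m k) \<le> sum_list (replicate n k)"
proof -
  have "0 \<le> sum_list (replicate (n - m) k)"
    using assms by (intro sum_list_nonneg_lom) auto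
  then have "sum_list (replicate m k) \<le> sum_list (replicate m k) + sum_list (replicate (n - m) k)"
    using translation_left_isotone[of 0 "sum_list (replicate (n - m) k)"] by fastforce
  also have "\<dots> = sum_list (replicate n k)"
    using assms(2) by (metis sum_list_append le_add_diff_inverse replicate_add)
  finally show ?thesis .
qed

lemma exists_count_list_gt:
  assumes "finite K" and "set ks \<subseteq> K" and "card K * m < length ks"
  obtains k where "k \<in> K" and "m < count_list ks k"
proof -
  have "\<exists>k\<in>K. m < count_list ks k"
  proof (rule ccontr)
    assume "\<not> ?thesis"
    then have "(\<Sum>k\<in>K. count_list ks k) \<le> of_nat (card K) * m"
      by (intro sum_bounded_above) (auto simp: not_less)
    with sum_count_set[OF assms(2,1)] assms(3) show False by simp
  qed
  with that show thesis by blast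
qed

text \<open>By pigeonhole a long list over the finite set \<open>K\<close> repeats one element many
  times, and (W) limits how often it can be repeated below \<open>y\<close>. The offset
  \<open>a\<close> stands for what remains of a path once its closed walks are removed; it ranges
  over a finite set, so one bound serves all offsets.\<close>

lemma assumption_W_length_bound:
  fixes K A :: "'r::{lattice_ordered_monoid, conditionally_complete_lattice} set"
  assumes W: "assumption_W TYPE('r)"
    and y: "Fin y < (monoid_join :: 'r extended)"
    and K: "finite K" "\<And>k. k \<in> K \<Longrightarrow> 0 < k"
    and A: "finite A"
  shows "\<exists>N. \<forall>ks a. set ks \<subseteq> K \<longrightarrow> a \<in> A \<longrightarrow> sum_list ks + a \<le> y \<longrightarrow> length ks \<le> N"
proof -
  \<comment> \<open>The guard \<open>a \<le> y\<close> puts \<open>a\<close> strictly below the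
    join, as (W) demands. It is recovered later from the sum of \<open>ks\<close> being
    nonnegative.\<close>
  have "\<exists>n. a \<le> y \<longrightarrow> \<not> sum_list (replicate n k) + a \<le> y" if "k \<in> K" for k a
  proof (cases "a \<le> y")
    case True
    then have "Fin a < (monoid_join :: 'r extended)"
      using y by (auto intro: le_less_trans[of _ "Fin y"])
    with W y K(2)[OF that] show ?thesis unfolding assumption_W_def by blast
  qed simp
  then obtain n where n: "\<And>k a. k \<in> K \<Longrightarrow> a \<le> y \<Longrightarrow> \<not> sum_list (replicate (n k a) k) + a \<le> y"
    by metis
  \<comment> \<open>Inserting 0 keeps the maximum defined when \<open>K\<close> or \<open>A\<close>
    is empty.\<close>
  define m where "m = Max (insert 0 ((\<lambda>(k, a). n k a) ` (K \<times> A)))"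
  have m: "n k a \<le> m" if "k \<in> K" "a \<in> A" for k a
    unfolding m_def using K(1) A that by (intro Max_ge) auto
  have "length ks \<le> card K * m" if ks: "set ks \<subseteq> K" and a: "a \<in> A" and le: "sum_list ks + a \<le> y" for ks a
  proof (rule ccontr)
    assume "\<not> length ks \<le> card K * m"
    then obtain k where k: "k \<in> K" "m < count_list ks k"
      using exists_count_list_gt[OF K(1) ks] by (metis not_le)
    have nonneg: "0 \<le> k'" if "k' \<in> set ks" for k'
      using that ks K(2) by (auto intro: less_imp_le)
    from nonneg have "0 \<le> sum_list ks" by (rule sum_list_nonneg_lom)
    then have "a \<le> sum_list ks + a" using translation_right_isotone[of 0 _ a] by simp
    with le have "a \<le> y" by (rule order_trans[rotated])
    have "sum_list (replicate (n k a) k) \<le> sum_list (replicate (count_list ks k) k)"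
      using k m[OF k(1) a] K(2) by (intro sum_list_replicate_mono_lom) (auto intro: less_imp_le)
    \<comment> \<open>The copies of \<open>k\<close> are isolated by deleting the other entries, not
      by reordering, since \<open>+\<close> may be noncommutative. Deleting nonnegative entries can
      only lower the sum.\<close>
    also have "\<dots> = sum_list (filter (\<lambda>k'. k' = k) ks)"
      by (induction ks) auto
    also have "\<dots> \<le> sum_list ks" using nonneg by (rule sum_list_filter_le_lom)
    finally have "sum_list (replicate (n k a) k) + a \<le> sum_list ks + a"
      by (rule translation_right_isotone)
    with le n[OF k(1) \<open>a \<le> y\<close>] show False by (meson order_trans)
  qed
  then show ?thesis by blast
qed

section \<open>Splitting short closed walks off long walks\<close>

lemma path_resource_Nil [simp]: "path_resource x [] = 0"
  by (simp add: path_resource_def)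

lemma path_resource_append [simp]:
  "path_resource x (P @ Q) = path_resource x P + path_resource x Q"
  by (simp add: path_resource_def)

context fin_digraph
begin

lemma awalk_path_dest: "awalk u P v \<Longrightarrow> path_dest G u P = v"
  by (auto simp: path_dest_def)

text \<open>Only the first \<open>card (verts G)\<close> arcs are searched: their vertex list has
  one entry more than there are vertices, so it repeats one, and a closed walk found there is short.
  Shortness leaves finitely many candidates, as the finite set \<open>K\<close> in
  \<open>assumption_W_length_bound\<close> requires.\<close>

lemma awalk_long_decomp:
  assumes "awalk u P v" and "card (verts G) \<le> length P"
  obtains Q C R where "P = Q @ C @ R" and "closed_w C" and "length C \<le> card (verts G)"
    and "awalk u (Q @ R) v"
proof -
  define n where "n = card (verts G)"
  let ?T = "take n P"
  define w where "w = awlast u ?T"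
  have TD: "awalk u ?T w" "awalk w (drop n P) v"
    using assms(1) awalk_append_iff[of u ?T "drop n P" v] by (simp_all add: w_def)
  have "\<not> distinct (awalk_verts u ?T)"
  proof
    assume "distinct (awalk_verts u ?T)"
    then have "length (awalk_verts u ?T) \<le> n"
      using TD(1) finite_verts unfolding n_def
      by (metis awalkE' card_mono distinct_card)
    then show False using assms(2) by (simp add: length_awalk_verts n_def)
  qed
  then obtain Q C R w' where T: "?T = Q @ C @ R" "0 < length C"
    "awalk u Q w'" "awalk w' C w'" "awalk w' R w"
    using awalk_not_distinct_decomp[OF TD(1)] by blast
  show thesis
  proof
    show "P = Q @ C @ (R @ drop n P)" using T(1) by (metis append.assoc append_take_drop_id)
    show "closed_w C" using T by (auto simp: closed_w_def)
    have "length ?T \<le> n" by simp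
    then show "length C \<le> card (verts G)" using T(1) by (simp add: n_def del: length_take)
    show "awalk u (Q @ R @ drop n P) v"
      using T(3,5) TD(2) by (blast intro: awalk_appendI)
  qed
qed

lemma length_le_card_verts_if_acyclic:
  assumes "\<nexists>C. closed_w C" and "awalk u P v"
  shows "length P \<le> card (verts G)"
  using assms by (meson awalk_long_decomp nat_le_linear)

text \<open>Commutativity is used to pull the closed walks out of the middle of \<open>P\<close>.\<close>

lemma awalk_short_closed_w_decomp:
  fixes x :: "'b \<Rightarrow> 'r::monoid_add"
  assumes comm: "\<And>r s :: 'r. r + s = s + r"
    and "awalk u P v"
  shows "\<exists>S Cs. awalk u S v \<and> length S \<le> card (verts G)
    \<and> (\<forall>C \<in> set Cs. closed_w C \<and> length C \<le> card (verts G))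
    \<and> path_resource x P = sum_list (map (path_resource x) Cs) + path_resource x S
    \<and> length P \<le> card (verts G) * Suc (length Cs)"
  using assms(2)
proof (induction P rule: length_induct)
  case (1 P)
  show ?case
  \<comment> \<open>Each removal shortens \<open>P\<close> by at most \<open>card (verts G)\<close>
    arcs and the remainder \<open>S\<close> is no longer than that, hence the factor
    \<open>Suc (length Cs)\<close>.\<close>
  proof (cases "length P < card (verts G)")
    case True
    with 1 show ?thesis by (intro exI[of _ P] exI[of _ "[]"]) auto
  next
    case False
    with 1 obtain Q C R where P: "P = Q @ C @ R" "closed_w C" "length C \<le> card (verts G)"
      "awalk u (Q @ R) v" by (metis awalk_long_decomp not_less)
    then have "length (Q @ R) < length P" by (auto simp: closed_w_def)
    with 1 P obtain S Cs where S: "awalk u S v" "length S \<le> card (verts G)"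
      "\<forall>C \<in> set Cs. closed_w C \<and> length C \<le> card (verts G)"
      "path_resource x (Q @ R) = sum_list (map (path_resource x) Cs) + path_resource x S"
      "length (Q @ R) \<le> card (verts G) * Suc (length Cs)" by metis
    have "path_resource x P = path_resource x C + path_resource x (Q @ R)"
      unfolding P path_resource_append by (metis comm add.assoc)
    with S P show ?thesis
      by (intro exI[of _ S] exI[of _ "C # Cs"]) (auto simp: add.assoc)
  qed
qed

end

section \<open>Invariant and partial correctness\<close>

text \<open>The assumption \<open>closed_nonneg\<close> is the common consequence of (a), (b) and
  (c) on which partial correctness rests. What distinguishes the three conditions enters later,
  through a bound on path lengths.\<close>

locale astar = fin_digraph G for G :: "('v, 'e) pre_digraph" +
  fixes orig dest :: 'v
    and x :: "'e \<Rightarrow> 'r::lattice_ordered_monoid"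
    and c :: "'r \<Rightarrow> real"
    and \<rho> :: "'r \<Rightarrow> nat"
    and b :: "'v \<Rightarrow> 'r"
  assumes orig_in_verts: "orig \<in> verts G"
    and mono_cost: "mono c"
    and mono_rho: "mono \<rho>"
    and bound_le: "\<And>v P. awalk v P dest \<Longrightarrow> b v \<le> path_resource x P"
    and closed_nonneg: "\<And>C. awalk dest C dest \<Longrightarrow> 0 \<le> path_resource x C"
begin

abbreviation key :: "'e awalk \<Rightarrow> real" where
  "key P \<equiv> c (bounded_resource G orig x b P)"

abbreviation feasible :: "'e awalk \<Rightarrow> bool" where
  "feasible \<equiv> feasible_path G orig dest x \<rho>"

definition invariant :: "'e astar_state \<Rightarrow> bool" where
  "invariant = (\<lambda>(L, UB).
     (\<forall>P \<in># L. \<exists>v. awalk orig P v)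
     \<and> (UB = Pinf \<or> (\<exists>P. feasible P \<and> UB = Fin (c (path_resource x P))))
     \<and> (\<forall>Q. feasible Q \<longrightarrow> UB \<le> Fin (c (path_resource x Q)) \<or> (\<exists>P R. P \<in># L \<and> Q = P @ R)))"

lemma invariant_init: "invariant astar_init"
  using orig_in_verts by (auto simp: invariant_def astar_init_def awalk_Nil_iff)

lemma bounded_resource_prefix_le:
  assumes "awalk orig (P @ R) dest"
  shows "bounded_resource G orig x b P \<le> path_resource x (P @ R)"
  using assms unfolding bounded_resource_def path_dest_def path_resource_append
  by (intro translation_left_isotone bound_le) simp

lemma prefix_test:
  assumes "feasible (P @ R)"
  shows "\<rho> (bounded_resource G orig x b P) = 0" and "key P \<le> c (path_resource x (P @ R))"
  using assms bounded_resource_prefix_le[of P R] monoD[OF mono_rho] monoD[OF mono_cost]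
  unfolding feasible_path_def by fastforce+

lemma feasible_prefix_cost_le:
  assumes "feasible (P @ R)" and "path_dest G orig P = dest"
  shows "c (path_resource x P) \<le> c (path_resource x (P @ R))"
proof -
  have "awalk dest R dest"
    using assms by (simp add: feasible_path_def path_dest_def)
  from translation_left_isotone[OF closed_nonneg[OF this], of "path_resource x P"]
  have "path_resource x P \<le> path_resource x (P @ R)" by simp
  then show ?thesis using mono_cost by (rule monoD[rotated])
qed

lemma awalk_snoc:
  assumes "awalk orig P v" and "a \<in> out_arcs G (path_dest G orig P)"
  shows "awalk orig (P @ [a]) (head G a)"
  using assms by (auto intro!: awalk_appendI[of orig P v] arc_implies_awalk simp: awalk_path_dest)

lemma invariant_step:
  assumes step: "astar_step G orig dest x c \<rho> b s t" and inv: "invariant s"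
  shows "invariant t"
proof -
  obtain L UB P where s: "s = (L, UB)" and P: "P \<in># L"
    and t: "t = astar_process G orig dest x c \<rho> b P (L - {#P#}, UB)"
    using step by (auto elim: astar_step.cases)
  obtain L' UB' where t': "t = (L', UB')" by (cases t)
  let ?upd = "path_dest G orig P = dest \<and> \<rho> (path_resource x P) = 0 \<and> Fin (c (path_resource x P)) < UB"
  let ?ext = "\<rho> (bounded_resource G orig x b P) = 0 \<and> Fin (key P) \<le> UB"
  let ?ch = "{# P @ [a]. a \<in># mset_set (out_arcs G (path_dest G orig P)) #}"
  have L': "L' = (if \<not> ?upd \<and> ?ext then L - {#P#} + ?ch else L - {#P#})"
    and UB': "UB' = (if ?upd then Fin (c (path_resource x P)) else UB)"
    using t t' by (auto simp: astar_process_def split: if_splits)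
  from inv have walks: "\<exists>v. awalk orig R v" if "R \<in># L" for R
    using that by (auto simp: s invariant_def)
  then obtain v where v: "awalk orig P v" using P by blast
  have "\<exists>v. awalk orig R v" if "R \<in># L'" for R
  proof -
    have "R \<in># L - {#P#} \<or> R \<in># ?ch"
      using that by (simp only: L' union_iff simp_thms split: if_splits)
    then have "R \<in># L \<or> (\<exists>a \<in> out_arcs G (path_dest G orig P). R = P @ [a])"
      by (auto simp: finite_out_arcs dest: in_diffD)
    with walks awalk_snoc[OF v] show ?thesis by blast
  qed
  moreover have "UB' = Pinf \<or> (\<exists>P. feasible P \<and> UB' = Fin (c (path_resource x P)))"
  proof (cases ?upd)
    case True
    then have "feasible P" using v awalk_path_dest[OF v] by (simp add: feasible_path_def)
    with True UB' show ?thesis by auto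
  next
    case False
    with UB' inv show ?thesis by (auto simp: s invariant_def)
  qed
  moreover have "UB' \<le> Fin (c (path_resource x Q)) \<or> (\<exists>P R. P \<in># L' \<and> Q = P @ R)"
    if Q: "feasible Q" for Q
  proof -
    have UB'_le: "UB' \<le> UB" using UB' by auto
    \<comment> \<open>Only in case \<open>prefix\<close>, where the witness for \<open>Q\<close> is
      the extracted path itself, must a new witness be found.\<close>
    consider (ub) "UB \<le> Fin (c (path_resource x Q))"
      | (other) P' R where "P' \<in># L - {#P#}" "Q = P' @ R"
      | (prefix) R where "Q = P @ R"
    proof -
      have "UB \<le> Fin (c (path_resource x Q)) \<or> (\<exists>P R. P \<in># L \<and> Q = P @ R)"
        using inv Q by (auto simp: s invariant_def)
      moreover have "P' = P \<or> P' \<in># L - {#P#}" if "P' \<in># L" for P'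
        using that P by (metis insert_DiffM insert_noteq_member)
      ultimately show thesis using that by blast
    qed
    then show ?thesis
    proof cases
      case ub
      with UB'_le show ?thesis by (meson order_trans)
    next
      case other
      with L' show ?thesis by auto
    next
      case (prefix R)
      note test = prefix_test[OF Q[unfolded prefix]]
      show ?thesis
      proof (cases ?upd)
        case True
        with UB' feasible_prefix_cost_le[OF Q[unfolded prefix]] show ?thesis by (simp add: prefix)
      next
        case no_upd: False
        show ?thesis
        proof (cases R)
          \<comment> \<open>Here \<open>P\<close> is \<open>Q\<close> itself, so only the cost
            comparison can have blocked the update: the upper bound is already at most the cost of
            \<open>Q\<close>.\<close>
          case Nil
          then have "\<rho> (path_resource x P) = 0" "path_dest G orig P = dest"
            using Q prefix awalk_path_dest by (auto simp: feasible_path_def)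
          with no_upd Nil prefix UB'_le show ?thesis by auto
        next
          case (Cons a R')
          show ?thesis
          proof (cases "Fin (key P) \<le> UB")
            case True
            have "a \<in> out_arcs G (path_dest G orig P)"
              using Q prefix Cons by (auto simp: feasible_path_def awalk_Cons_iff path_dest_def)
            then have "P @ [a] \<in># ?ch" by (auto simp: finite_out_arcs)
            then have "P @ [a] \<in># L'" using L' no_upd True test(1) by auto
            with prefix Cons show ?thesis by (intro disjI2 exI[of _ "P @ [a]"] exI[of _ R']) auto
          next
            \<comment> \<open>Pruning \<open>P\<close> loses nothing: its key exceeds the upper
              bound and is at most the cost of \<open>Q\<close>.\<close>
            case False
            then have "UB \<le> Fin (key P)" by simp
            also have "\<dots> \<le> Fin (c (path_resource x Q))" using test(2) prefix by simp
            finally show ?thesis using UB'_le by (meson order_trans)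
          qed
        qed
      qed
    qed
  qed
  ultimately show ?thesis by (auto simp: t' invariant_def)
qed

lemma invariant_reachable:
  assumes "(astar_step G orig dest x c \<rho> b)\<^sup>*\<^sup>* astar_init s"
  shows "invariant s"
  using assms by induction (auto intro: invariant_init invariant_step)

text \<open>On an empty list the third conjunct of \<open>invariant\<close> makes \<open>UB\<close>
  a lower bound on all feasible costs, and the second says that a finite \<open>UB\<close> is
  attained.\<close>

lemma partial_correctness:
  assumes "(astar_step G orig dest x c \<rho> b)\<^sup>*\<^sup>* astar_init ({#}, UB)"
  shows "if UB \<noteq> Pinf
    then \<exists>P. optimal_path G orig dest x c \<rho> P \<and> UB = Fin (c (path_resource x P))
    else \<nexists>P. feasible P"
  using invariant_reachable[OF assms] by (force simp: invariant_def optimal_path_def)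

section \<open>Termination\<close>

text \<open>Every path that gets extended meets the premises of \<open>len\<close>, so it has length
  at most \<open>N\<close> and is replaced by paths of smaller measure. The measure starts from
  \<open>Suc N\<close> because the extensions of a path of length \<open>N\<close> must still come
  out smaller under truncated subtraction.\<close>

lemma astar_step_decreases:
  assumes len: "\<And>P. \<lbrakk>awalk orig P (path_dest G orig P); \<rho> (bounded_resource G orig x b P) = 0;
      \<And>Q. feasible Q \<Longrightarrow> key P \<le> c (path_resource x Q)\<rbrakk> \<Longrightarrow> length P \<le> N"
    and step: "astar_step G orig dest x c \<rho> b s t" and inv: "invariant s"
  shows "(fst t, fst s) \<in> mult (measure (\<lambda>P. Suc N - length P))"
proof -
  obtain L UB P where s: "s = (L, UB)" and P: "P \<in># L"
    and min: "\<And>Q. Q \<in># L \<Longrightarrow> key P \<le> key Q"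
    and t: "t = astar_process G orig dest x c \<rho> b P (L - {#P#}, UB)"
    using step by (auto elim!: astar_step.cases)
  define K where "K = fst t - (L - {#P#})"
  have "fst t = (L - {#P#}) + K \<and> (\<forall>R \<in># K. length R = Suc (length P) \<and> length P \<le> N)"
  proof (cases "fst t = L - {#P#}")
    case True
    then show ?thesis by (simp add: K_def)
  next
    case False
    then have ext: "\<rho> (bounded_resource G orig x b P) = 0" "Fin (key P) \<le> UB"
      and L': "fst t = L - {#P#} + {# P @ [a]. a \<in># mset_set (out_arcs G (path_dest G orig P)) #}"
      unfolding t astar_process_def by (auto split: if_splits)
    have "awalk orig P (path_dest G orig P)"
      using inv P awalk_path_dest by (force simp: s invariant_def)
    moreover have "key P \<le> c (path_resource x Q)" if Q: "feasible Q" for Q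
    proof -
      have "UB \<le> Fin (c (path_resource x Q)) \<or> (\<exists>P R. P \<in># L \<and> Q = P @ R)"
        using inv Q by (auto simp: s invariant_def)
      then show ?thesis
      proof (elim disjE exE conjE)
        assume "UB \<le> Fin (c (path_resource x Q))"
        with ext(2) show ?thesis by (metis order_trans less_eq_extended.simps(1))
      next
        \<comment> \<open>The selection rule enters here: \<open>key P\<close> is at most
          \<open>key R\<close>, which is at most the cost of \<open>Q\<close> because
          \<open>R\<close> is a prefix of \<open>Q\<close>.\<close>
        fix R R' assume R: "R \<in># L" "Q = R @ R'"
        with min prefix_test(2) Q show ?thesis by (meson order_trans)
      qed
    qed
    ultimately have "length P \<le> N" using len ext(1) by blast
    with L' show ?thesis by (auto simp: K_def)
  qed
  then have "fst t = L - {#P#} + K"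
    and "\<forall>R \<in># K. \<exists>P' \<in># {#P#}. (R, P') \<in> measure (\<lambda>P. Suc N - length P)"
    by auto
  with P one_step_implies_mult[of "{#P#}" K "measure (\<lambda>P. Suc N - length P)" "L - {#P#}"]
  show ?thesis by (simp add: s)
qed

lemma no_infinite_run:
  assumes len: "\<And>P. \<lbrakk>awalk orig P (path_dest G orig P); \<rho> (bounded_resource G orig x b P) = 0;
      \<And>Q. feasible Q \<Longrightarrow> key P \<le> c (path_resource x Q)\<rbrakk> \<Longrightarrow> length P \<le> N"
  shows "\<nexists>s. s 0 = astar_init \<and> (\<forall>i. astar_step G orig dest x c \<rho> b (s i) (s (Suc i)))"
proof
  assume "\<exists>s. s 0 = astar_init \<and> (\<forall>i. astar_step G orig dest x c \<rho> b (s i) (s (Suc i)))"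
  then obtain s where init: "s 0 = astar_init"
    and step: "\<And>i. astar_step G orig dest x c \<rho> b (s i) (s (Suc i))" by blast
  have "invariant (s i)" for i
  proof (induction i)
    case 0
    then show ?case using init invariant_init by simp
  next
    case (Suc i)
    with step show ?case by (rule invariant_step)
  qed
  then have "(fst (s (Suc i)), fst (s i)) \<in> mult (measure (\<lambda>P. Suc N - length P))" for i
    using astar_step_decreases[OF len step] by blast
  then have "\<exists>f. \<forall>i. (f (Suc i), f i) \<in> mult (measure (\<lambda>P :: 'e awalk. Suc N - length P))"
    by (intro exI[of _ "\<lambda>i. fst (s i)"]) simp
  moreover have "wf (mult (measure (\<lambda>P :: 'e awalk. Suc N - length P)))"
    by (intro wf_mult) simp
  ultimately show False
    unfolding wf_iff_no_infinite_down_chain by blast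
qed

end

section \<open>Closed walks and path lengths under (a), (b) and (c)\<close>

theorem theorem1:
  fixes G :: "('v, 'e) pre_digraph"
    and orig dest :: 'v
    and x :: "'e \<Rightarrow> 'r::{lattice_ordered_monoid, conditionally_complete_lattice}"
    and c :: "'r \<Rightarrow> real"
    and \<rho> :: "'r \<Rightarrow> nat"
    and b :: "'v \<Rightarrow> 'r"
  assumes "fin_digraph G"
    and "orig \<in> verts G" and "dest \<in> verts G"
    and "mono c"
    and "range \<rho> \<subseteq> {0, 1}" and "mono \<rho>"
    and "\<forall>v \<in> verts G. \<forall>P. pre_digraph.awalk G v P dest \<longrightarrow> b v \<le> path_resource x P"
    and "(\<nexists>C. wf_digraph.closed_w G C)
       \<or> (assumption_W TYPE('r) \<and> assumption_B G orig dest x c \<rho>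
           \<and> (\<forall>a \<in> arcs G. 0 < x a) \<and> (\<forall>v \<in> verts G. 0 \<le> b v))
       \<or> (assumption_W TYPE('r) \<and> assumption_B G orig dest x c \<rho>
           \<and> (\<forall>r s :: 'r. r + s = s + r)
           \<and> (\<forall>C. wf_digraph.closed_w G C \<longrightarrow> 0 < path_resource x C))"
  shows "(\<nexists>s. s 0 = astar_init \<and> (\<forall>i. astar_step G orig dest x c \<rho> b (s i) (s (Suc i))))
    \<and> (\<forall>UB. (astar_step G orig dest x c \<rho> b)\<^sup>*\<^sup>* astar_init ({#}, UB) \<longrightarrow>
         (if UB \<noteq> Pinf
          then \<exists>P. optimal_path G orig dest x c \<rho> P \<and> UB = Fin (c (path_resource x P))
          else \<nexists>P. feasible_path G orig dest x \<rho> P))"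
proof -
  interpret fin_digraph G by fact
  \<comment> \<open>Under (a) only the empty closed walk exists; under (b) every arc is positive,
    and under (c) every nonempty closed walk is.\<close>
  have closed_nonneg: "0 \<le> path_resource x C" if "awalk dest C dest" for C
  proof (cases "C = []")
    case False
    with that have C: "closed_w C" by (auto simp: closed_w_def)
    show ?thesis
      using assms(8)
    proof (elim disjE conjE)
      assume "\<forall>a \<in> arcs G. 0 < x a"
      with that show ?thesis
        unfolding path_resource_def
        by (intro sum_list_nonneg_lom) (fastforce intro: less_imp_le)
    qed (use C in \<open>auto intro: less_imp_le\<close>)
  qed simp
  interpret astar G orig dest x c \<rho> b
    using assms(2,4,6,7) closed_nonneg awalk_hd_in_verts by unfold_locales blast+
  have "\<exists>N. \<forall>P. awalk orig P (path_dest G orig P) \<longrightarrow> \<rho> (bounded_resource G orig x b P) = 0 \<longrightarrow>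
      (\<forall>Q. feasible Q \<longrightarrow> key P \<le> c (path_resource x Q)) \<longrightarrow> length P \<le> N"
    using assms(8)
  proof (elim disjE conjE)
    assume "\<nexists>C. closed_w C"
    then show ?thesis using length_le_card_verts_if_acyclic by blast
  next
    assume W: "assumption_W TYPE('r)" and B: "assumption_B G orig dest x c \<rho>"
      and arcs: "\<forall>a \<in> arcs G. 0 < x a" and b: "\<forall>v \<in> verts G. 0 \<le> b v"
    from B obtain Q y where Q: "feasible Q" and y: "Fin y < (monoid_join :: 'r extended)"
      and le_y: "\<And>r. c r \<le> c (path_resource x Q) \<Longrightarrow> \<rho> r = 0 \<Longrightarrow> r \<le> y"
      unfolding assumption_B_def by auto
    \<comment> \<open>The single offset 0 suffices: as \<open>b\<close> is nonnegative, the bound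
      \<open>y\<close> on \<open>bounded_resource\<close> passes to the path resource
      itself.\<close>
    obtain N where N: "\<And>ks. set ks \<subseteq> x ` arcs G \<Longrightarrow> sum_list ks \<le> y \<Longrightarrow> length ks \<le> N"
      using assumption_W_length_bound[OF W y, of "x ` arcs G" "{0}"] arcs by auto
    have "length P \<le> N" if P: "awalk orig P (path_dest G orig P)"
      and "\<rho> (bounded_resource G orig x b P) = 0" and "key P \<le> c (path_resource x Q)" for P
    proof -
      have "path_resource x P \<le> bounded_resource G orig x b P"
        using b awalk_last_in_verts[OF P] translation_left_isotone[of 0 _ "path_resource x P"]
        unfolding bounded_resource_def by fastforce
      also have "\<dots> \<le> y" using that by (intro le_y)
      finally show ?thesis
        using N[of "map x P"] P by (auto simp: path_resource_def)
    qed
    with Q show ?thesis by blast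
  next
    assume W: "assumption_W TYPE('r)" and B: "assumption_B G orig dest x c \<rho>"
      and comm: "\<forall>r s :: 'r. r + s = s + r"
      and cyc: "\<forall>C. closed_w C \<longrightarrow> 0 < path_resource x C"
    from B obtain Q y where Q: "feasible Q" and y: "Fin y < (monoid_join :: 'r extended)"
      and le_y: "\<And>r. c r \<le> c (path_resource x Q) \<Longrightarrow> \<rho> r = 0 \<Longrightarrow> r \<le> y"
      unfolding assumption_B_def by auto
    define n where "n = card (verts G)"
    \<comment> \<open>This finite set holds both the short closed walks, whose resources form
      \<open>K\<close>, and the remainders \<open>S\<close>, whose resources combined with the
      bounds form \<open>A\<close>.\<close>
    define short where "short = {S. set S \<subseteq> arcs G \<and> length S \<le> n}"
    have short: "finite short"
      unfolding short_def by (intro finite_lists_length_le finite_arcs)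
    define K where "K = path_resource x ` {C \<in> short. closed_w C}"
    define A where "A = (\<lambda>(S, v). path_resource x S + b v) ` (short \<times> verts G)"
    obtain N where N: "\<And>ks a. set ks \<subseteq> K \<Longrightarrow> a \<in> A \<Longrightarrow> sum_list ks + a \<le> y \<Longrightarrow> length ks \<le> N"
    proof -
      have "finite K" "finite A" and "\<And>k. k \<in> K \<Longrightarrow> 0 < k"
        using short cyc finite_verts by (auto simp: K_def A_def)
      from assumption_W_length_bound[OF W y this(1,3,2)] that show thesis by blast
    qed
    \<comment> \<open>At most \<open>N\<close> closed walks and one remainder, each of length at
      most \<open>n\<close>.\<close>
    have "length P \<le> n * Suc N" if P: "awalk orig P (path_dest G orig P)"
      and "\<rho> (bounded_resource G orig x b P) = 0" and "key P \<le> c (path_resource x Q)" for P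
    proof -
      obtain S Cs where S: "awalk orig S (path_dest G orig P)" "length S \<le> n"
        and Cs: "\<forall>C \<in> set Cs. closed_w C \<and> length C \<le> n"
        and res: "path_resource x P = sum_list (map (path_resource x) Cs) + path_resource x S"
        and len: "length P \<le> n * Suc (length Cs)"
        using awalk_short_closed_w_decomp[OF _ P, of x] comm unfolding n_def by blast
      have "sum_list (map (path_resource x) Cs) + (path_resource x S + b (path_dest G orig P)) \<le> y"
        using le_y that by (simp add: bounded_resource_def res add.assoc)
      moreover have "set (map (path_resource x) Cs) \<subseteq> K"
      proof -
        have "C \<in> short" if "C \<in> set Cs" for C
          using Cs that by (auto simp: short_def closed_w_def)
        with Cs show ?thesis by (auto simp: K_def)
      qed
      moreover have "path_resource x S + b (path_dest G orig P) \<in> A"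
        using S awalk_last_in_verts[OF S(1)] by (force simp: A_def short_def)
      ultimately have "length Cs \<le> N" using N by fastforce
      with len show ?thesis by (meson Suc_le_mono mult_le_mono2 order_trans)
    qed
    with Q show ?thesis by blast
  qed
  then obtain N where "\<And>P. \<lbrakk>awalk orig P (path_dest G orig P); \<rho> (bounded_resource G orig x b P) = 0;
      \<And>Q. feasible Q \<Longrightarrow> key P \<le> c (path_resource x Q)\<rbrakk> \<Longrightarrow> length P \<le> N"
    by blast
  from no_infinite_run[OF this] partial_correctness show ?thesis by blast
qed

end
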